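(* No deterministic online algorithm for the online frequent items problem (buffer of size one) has a competitive function better than $\frac{\sqrt n}{2}$; that is, for every deterministic online algorithm $\mathcal A$ with competitive function $f(n)$, it is not the case that $\lim_{n\to\infty}\frac{f(n)}{\sqrt n/2}<1$.
   Context: Online frequent items problem: an input sequence is $I=a_1,\ldots,a_n$ of items from an infinite universe, $n=|I|$, revealed one at a time. An algorithm maintains a buffer holding one item; $s_t$ is the buffer content after step $t$; at step $1$ the buffer receives $a_1$, and at each later step $t$ the algorithm either keeps $s_{t-1}$ or replaces it by $a_t$. An online algorithm decides at step $t$ knowing only $a_1,\ldots,a_t$. With $f_I(a)=|\{i:a_i=a\}|/n$, the aggregate frequency of $\mathcal A$ on $I$ is $\mathcal A(I)=\sum_{t=1}^n f_I(s^{\mathcal A}_t)$ (to be maximized). Opt denotes an optimal offline algorithm (knows all of $I$ in advance, same buffer rules). Competitive function: $\mathcal A$ is $f(n)$-competitive if there is $h\in o(f)$ such that for all input sequences $I$ (with $n=|I|$), $\mathrm{Opt}(I)\le (f(n)+h(n))\,\mathcal A(I)$. $\mathcal A$ has competitive function $f(n)$ if it is $f(n)$-competitive and for every $g(n)$ such that $\mathcal A$ is $g(n)$-competitive, $\lim_{n\to\infty} f(n)/g(n)\le 1$. A competitive function $f$ is better than $f'$ if $\lim_{n\to\infty} f(n)/f'(n)<1$. *)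

theory Defs
  imports Complex_Main "HOL-Library.Landau_Symbols" "HOL-Library.Extended_Real"
    "HOL-Library.Liminf_Limsup"
begin

definition freq :: "'a list \<Rightarrow> 'a \<Rightarrow> real" where
  "freq I a = real (count_list I a) / real (length I)"

text \<open>
  Positions are counted from 0: the entries \<open>I ! t\<close> and \<open>s ! t\<close> are the item and the buffer
  content of step \<open>t + 1\<close>.  A run lists the buffer contents after each step.
\<close>

definition is_run :: "'a list \<Rightarrow> 'a list \<Rightarrow> bool" where
  "is_run I s \<longleftrightarrow> length s = length I \<and> (I \<noteq> [] \<longrightarrow> s ! 0 = I ! 0) \<and>
     (\<forall>t. Suc t < length I \<longrightarrow> s ! Suc t = s ! t \<or> s ! Suc t = I ! Suc t)"

definition aggregate_freq :: "'a list \<Rightarrow> 'a list \<Rightarrow> real" where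
  "aggregate_freq I s = (\<Sum>t<length I. freq I (s ! t))"

definition Opt :: "'a list \<Rightarrow> real" where
  "Opt I = Max (aggregate_freq I ` {s. is_run I s})"

text \<open>
  A deterministic online algorithm maps the prefix seen so far to a decision: \<open>True\<close> means that
  the buffer is replaced by the last item of that prefix.  The previous buffer content is itself
  determined by the prefix.  The decision on a prefix of length 1 is irrelevant.
\<close>

type_synonym 'a online_alg = "'a list \<Rightarrow> bool"

primrec buffer :: "'a online_alg \<Rightarrow> 'a list \<Rightarrow> nat \<Rightarrow> 'a" where
  "buffer A I 0 = I ! 0"
| "buffer A I (Suc t) =
     (if A (take (Suc (Suc t)) I) then I ! Suc t else buffer A I t)"

definition alg_run :: "'a online_alg \<Rightarrow> 'a list \<Rightarrow> 'a list" where
  "alg_run A I = map (buffer A I) [0..<length I]"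

definition alg_value :: "'a online_alg \<Rightarrow> 'a list \<Rightarrow> real" where
  "alg_value A I = aggregate_freq I (alg_run A I)"

definition competitive :: "'a online_alg \<Rightarrow> (nat \<Rightarrow> real) \<Rightarrow> bool" where
  "competitive A f \<longleftrightarrow> (\<exists>h\<in>o(f). \<forall>I. Opt I \<le> (f (length I) + h (length I)) * alg_value A I)"

text \<open>
  The comparisons \<open>lim f/g \<le> 1\<close> and \<open>lim f/g < 1\<close> are read with \<open>limsup\<close>, since the limit need
  not exist.  Requiring it to exist would leave no algorithm with a competitive function: if \<open>A\<close>
  is \<open>f\<close>-competitive, then it is also \<open>g\<close>-competitive for \<open>g n = (2 + (-1)^n) * f n\<close>, and
  \<open>f/g\<close> has no limit.
\<close>

definition has_competitive_function :: "'a online_alg \<Rightarrow> (nat \<Rightarrow> real) \<Rightarrow> bool" where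
  "has_competitive_function A f \<longleftrightarrow> competitive A f \<and>
     (\<forall>g. competitive A g \<longrightarrow> limsup (\<lambda>n. ereal (f n / g n)) \<le> 1)"

definition better_than :: "(nat \<Rightarrow> real) \<Rightarrow> (nat \<Rightarrow> real) \<Rightarrow> bool" where
  "better_than f f' \<longleftrightarrow> limsup (\<lambda>n. ereal (f n / f' n)) < 1"

lemma better_than_if_limit:
  assumes "(\<lambda>n. f n / f' n) \<longlonglongrightarrow> L" "L < 1"
  shows "better_than f f'"
proof -
  have "(\<lambda>n. ereal (f n / f' n)) \<longlonglongrightarrow> ereal L" using assms(1) by simp
  then have "limsup (\<lambda>n. ereal (f n / f' n)) = ereal L"
    by (intro lim_imp_Limsup) auto
  with assms(2) show ?thesis by (simp add: better_than_def)
qed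

lemma is_run_alg_run: "is_run I (alg_run A I)"
  by (auto simp: is_run_def alg_run_def)

text \<open>The maximum in \<^const>\<open>Opt\<close> ranges over a finite nonempty set.\<close>

lemma finite_runs: "finite {s. is_run I s}"
proof (rule finite_subset)
  show "{s. is_run I s} \<subseteq> {s. set s \<subseteq> set I \<and> length s = length I}"
  proof safe
    fix s x assume s: "is_run I s" and "x \<in> set s"
    then obtain t where t: "t < length s" "x = s ! t" by (auto simp: in_set_conv_nth)
    have "t < length I \<Longrightarrow> s ! t \<in> set I" for t
    proof (induction t)
      case 0
      then show ?case using s by (auto simp: is_run_def)
    next
      case (Suc t)
      then have "s ! Suc t = s ! t \<or> s ! Suc t = I ! Suc t" using s by (auto simp: is_run_def)
      with Suc show ?case by auto
    qed
    then show "x \<in> set I" using t s by (simp add: is_run_def)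
  qed (simp add: is_run_def)
  show "finite {s. set s \<subseteq> set I \<and> length s = length I}"
    by (rule finite_lists_length_eq) simp
qed

lemma alg_value_le_Opt: "alg_value A I \<le> Opt I"
  unfolding alg_value_def Opt_def using finite_runs is_run_alg_run by (intro Max_ge) auto

end

theory Submission
  imports Defs
begin

text \<open>
  With \<open>n = K\<^sup>4\<close> and \<open>M = K\<^sup>2 = sqrt n\<close>, feed the algorithm \<open>n - M\<close> distinct items, observe which
  of the first \<open>K\<^sup>3\<close> of them it holds for the shortest total time, and finish with \<open>M\<close> more copies
  of that item.  The offline optimum picks it up within the first \<open>K\<^sup>3 = o(n)\<close> steps and collects
  about \<open>M\<close>.  By pigeonhole, the algorithm has held it for at most \<open>n / K\<^sup>3 = K\<close> steps before the
  copies arrive, so it collects at most 1 from the distinct items, at most 1 during the final \<open>M\<close>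
  steps, and a vanishing amount from the early visits to the chosen item.
\<close>

text \<open>This is where being online enters: earlier decisions see only their own prefix, so the
  tail can be chosen after watching the algorithm on \<open>xs\<close>.\<close>

lemma buffer_append:
  "t < length xs \<Longrightarrow> buffer A (xs @ ys) t = buffer A xs t"
  by (induction t) (auto simp: nth_append)

lemma aggregate_freq_eq_sum_count:
  "length I * aggregate_freq I s = (\<Sum>t<length I. real (count_list I (s ! t)))"
  by (cases "I = []") (simp_all add: aggregate_freq_def freq_def flip: sum_divide_distrib)

lemma Opt_ge: "is_run I s \<Longrightarrow> aggregate_freq I s \<le> Opt I"
  unfolding Opt_def using finite_runs by (intro Max_ge) auto

lemma count_list_le_1: "distinct xs \<Longrightarrow> count_list xs a \<le> 1"
  by (induction xs) auto

lemma count_list_replicate: "count_list (replicate m b) a = (if a = b then m else 0)"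
  by (induction m) auto

text \<open>Injectivity makes the \<open>k\<close> sets of visiting times disjoint, so they share at
  most \<open>N\<close> moments and cannot all exceed the average.\<close>

lemma exists_rarely_visited:
  fixes b :: "nat \<Rightarrow> 'a" and x :: "nat \<Rightarrow> 'a"
  assumes "inj x" and "0 < k"
  shows "\<exists>j<k. k * card {t. t < N \<and> b t = x j} \<le> N"
proof (rule ccontr)
  let ?H = "\<lambda>j. {t. t < N \<and> b t = x j}"
  assume "\<not> ?thesis"
  then have "\<And>j. j \<in> {..<k} \<Longrightarrow> N < k * card (?H j)" by force
  then have "(\<Sum>j<k. N) < (\<Sum>j<k. k * card (?H j))"
    using assms by (intro sum_strict_mono) auto
  also have "\<dots> = k * (\<Sum>j<k. card (?H j))" by (simp add: sum_distrib_left)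
  also have "(\<Sum>j<k. card (?H j)) = card (\<Union>j<k. ?H j)"
    using assms by (intro card_UN_disjoint[symmetric]) (auto dest: injD)
  also have "\<dots> \<le> card {..<N}" by (intro card_mono) auto
  finally show False by simp
qed

text \<open>Waiting for the chosen item costs the offline run a fraction of at most
  \<open>1 / K\<close> of a total of \<open>K ^ 2\<close>. The early visits give the algorithm at
  most \<open>K * K ^ 2 / n = 1 / K\<close>.\<close>

lemma adversarial_input:
  fixes A :: "'a online_alg"
  assumes inf: "infinite (UNIV :: 'a set)" and K: "2 \<le> K"
  shows "\<exists>I. length I = K ^ 4 \<and> real K ^ 2 - real K \<le> Opt I \<and> alg_value A I \<le> 2 + 1 / real K"
proof -
  obtain x :: "nat \<Rightarrow> 'a" where x: "inj x"
    using inf infinite_countable_subset by blast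
  define M where "M = K ^ 2"
  define n where "n = K ^ 4"
  define N where "N = n - M"
  define D where "D = map x [0..<N]"
  have "M \<le> n" unfolding M_def n_def using K by (intro power_increasing) auto
  \<comment> \<open>The \<open>K ^ 3\<close> candidates must fit in front of the tail of length
    \<open>M\<close>; this needs \<open>2 \<le> K\<close>.\<close>
  have "K ^ 3 + K ^ 2 \<le> 2 * K ^ 3" using K by (simp add: power_increasing)
  also have "\<dots> \<le> K ^ 4"
    using mult_right_mono[OF K, of "K ^ 3"] by (simp add: eval_nat_numeral)
  finally have kN: "K ^ 3 \<le> N" by (simp add: N_def n_def M_def)
  obtain j where j: "j < K ^ 3"
    and visits: "K ^ 3 * card {t. t < N \<and> buffer A D t = x j} \<le> N"
    using exists_rarely_visited[OF x, of "K ^ 3" N "buffer A D"] K by auto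
  define V where "V = {t. t < N \<and> buffer A D t = x j}"
  define I where "I = D @ replicate M (x j)"
  have len: "length I = n" using \<open>M \<le> n\<close> by (simp add: I_def D_def N_def)
  have lenD: "length D = N" by (simp add: D_def)
  have n_pos: "0 < n" and K_pos: "0 < real K" using K by (auto simp: n_def)
  have n_real: "real n = real K ^ 4" by (simp add: n_def)
  have distD: "distinct D" using x by (auto simp: D_def distinct_map intro: inj_on_subset)
  have count: "real (count_list I a) \<le> 1 + (if a = x j then real M else 0)" for a
    using count_list_le_1[OF distD, of a] by (auto simp: I_def count_list_replicate)

  have "n * alg_value A I = (\<Sum>t<n. real (count_list I (buffer A I t)))"
    unfolding alg_value_def
    using aggregate_freq_eq_sum_count[of I "alg_run A I"] by (simp add: len alg_run_def)
  \<comment> \<open>The summand 1 pays for the single occurrence in \<open>D\<close>. In the tail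
    the algorithm is granted \<open>x j\<close> at every step.\<close>
  also have "\<dots> \<le> (\<Sum>t<n. 1 + ((if t \<in> V then real M else 0) + (if t \<in> {N..<n} then real M else 0)))"
  proof (rule sum_mono)
    fix t assume "t \<in> {..<n}"
    then show "real (count_list I (buffer A I t))
        \<le> 1 + ((if t \<in> V then real M else 0) + (if t \<in> {N..<n} then real M else 0))"
    proof (cases "t < N")
      case True
      then have "buffer A I t = buffer A D t"
        unfolding I_def using lenD by (intro buffer_append) simp
      then show ?thesis using count[of "buffer A I t"] True by (simp add: V_def)
    next
      case False
      then show ?thesis
        using count[of "buffer A I t"] \<open>t \<in> {..<n}\<close> by (auto simp: V_def split: if_splits)
    qed
  qed
  also have "\<dots> = n + (card ({..<n} \<inter> V) * M + card ({..<n} \<inter> {N..<n}) * M)"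
    by (simp add: sum.distrib del: atLeastLessThan_iff flip: sum.inter_restrict)
  also have "{..<n} \<inter> V = V" by (auto simp: V_def N_def)
  also have "{..<n} \<inter> {N..<n} = {N..<n}" by auto
  also have "card {N..<n} = M" using \<open>M \<le> n\<close> by (simp add: N_def)
  finally have *: "n * alg_value A I \<le> n + (card V * M + M * M)" by simp
  have "K ^ 3 * card V \<le> N" using visits by (simp add: V_def)
  also have "\<dots> \<le> n" by (simp add: N_def)
  also have "n = K ^ 3 * K" by (simp add: n_def eval_nat_numeral)
  finally have "K ^ 3 * card V \<le> K ^ 3 * K" .
  then have "card V \<le> K" using K by simp
  then have "card V * M \<le> K ^ 3" by (simp add: M_def eval_nat_numeral)
  \<comment> \<open>The choice \<open>M = sqrt n\<close> makes the whole tail worth just 1 after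
    division by \<open>n\<close>.\<close>
  moreover have "M * M = n" by (simp add: M_def n_def eval_nat_numeral)
  ultimately have "card V * M + M * M \<le> K ^ 3 + n" by simp
  then have "real (card V * M + M * M) \<le> real (K ^ 3 + n)" by (rule of_nat_mono)
  with * have "n * alg_value A I \<le> 2 * real n + real K ^ 3" by simp
  also have "\<dots> = n * (2 + 1 / real K)"
    using K_pos by (simp add: n_real field_simps eval_nat_numeral)
  finally have alg: "alg_value A I \<le> 2 + 1 / real K" using n_pos by simp

  \<comment> \<open>The offline run waits on the first item and switches to \<open>x j\<close> when
    it arrives; for \<open>j = 0\<close> it holds \<open>x 0\<close> throughout.\<close>
  define s where "s = map (\<lambda>t. if t < j then x 0 else x j) [0..<n]"
  have "N > 0" using j kN by simp
  then have I0: "I ! 0 = x 0" by (simp add: I_def D_def nth_append)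
  have Ij: "I ! j = x j" using j kN by (simp add: I_def D_def nth_append)
  have run: "is_run I s"
    unfolding is_run_def
  proof (intro conjI allI impI)
    show "length s = length I" by (simp add: s_def len)
    show "s ! 0 = I ! 0" using n_pos by (simp add: s_def I0)
    fix t assume "Suc t < length I"
    then show "s ! Suc t = s ! t \<or> s ! Suc t = I ! Suc t"
      using Ij by (cases "Suc t = j") (auto simp: s_def len)
  qed
  have "real K ^ 3 \<le> real n" using kN by (simp add: N_def flip: of_nat_power)
  have "(real n - real K ^ 3) * M \<le> (real n - j) * M"
    using j by (intro mult_right_mono diff_left_mono) (auto simp flip: of_nat_power)
  also have "\<dots> = (\<Sum>t\<in>{j..<n}. real M)"
    using j kN by (simp add: N_def of_nat_diff)
  also have "\<dots> \<le> (\<Sum>t\<in>{j..<n}. real (count_list I (s ! t)))"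
    by (intro sum_mono) (auto simp: s_def I_def count_list_replicate)
  also have "\<dots> \<le> (\<Sum>t<n. real (count_list I (s ! t)))"
    by (intro sum_mono2) auto
  also have "\<dots> = n * aggregate_freq I s"
    using aggregate_freq_eq_sum_count[of I s] by (simp add: len)
  also have "\<dots> \<le> n * Opt I" by (intro mult_left_mono Opt_ge run) simp
  finally have "(real n - real K ^ 3) * M \<le> n * Opt I" .
  moreover have "(real n - real K ^ 3) * M = n * (real K ^ 2 - real K)"
    by (simp add: n_real M_def algebra_simps eval_nat_numeral)
  ultimately have "real K ^ 2 - real K \<le> Opt I" using n_pos by simp
  with alg len show ?thesis unfolding n_def by blast
qed

lemma alg_value_nonneg: "0 \<le> alg_value A I"
  by (simp add: alg_value_def aggregate_freq_def freq_def sum_nonneg)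

text \<open>The limsup leaves a gap below 1, and the term \<open>h\<close> in \<open>o(f)\<close>
  uses up only part of it.\<close>

lemma competitive_better_imp_ratio:
  assumes "competitive A f" and "better_than f (\<lambda>n. sqrt (real n) / 2)"
  obtains d where "0 < d" "d < 1"
    "eventually (\<lambda>n. \<forall>I. length I = n \<longrightarrow> Opt I \<le> d * (sqrt n / 2) * alg_value A I) sequentially"
proof -
  obtain c0 where "limsup (\<lambda>n. ereal (f n / (sqrt n / 2))) < ereal c0" "ereal c0 < 1"
    using assms(2) ereal_dense2 unfolding better_than_def by blast
  \<comment> \<open>\<open>c0\<close> may be negative; the maximum keeps the final factor
    positive.\<close>
  define c where "c = max c0 (1/2)"
  have c: "0 < c" "c < 1" using \<open>ereal c0 < 1\<close> by (auto simp: c_def)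
  have "eventually (\<lambda>n. ereal (f n / (sqrt n / 2)) < ereal c0) sequentially"
    using \<open>limsup _ < ereal c0\<close> by (rule Limsup_lessD)
  then have ev_f: "eventually (\<lambda>n. f n / (sqrt n / 2) < c) sequentially"
    by eventually_elim (auto simp: c_def)
  define e where "e = (1 - c) / 2"
  have e: "0 < e" "e < 1" using c by (auto simp: e_def)
  obtain h where h: "h \<in> o(f)"
    and le: "\<And>I. Opt I \<le> (f (length I) + h (length I)) * alg_value A I"
    using assms(1) unfolding competitive_def by blast
  have ev_h: "eventually (\<lambda>n. norm (h n) \<le> e * norm (f n)) sequentially"
    using landau_o.smallD[OF h e(1)] .
  have d: "0 < (1 + e) * c" "(1 + e) * c < 1"
  proof -
    show "0 < (1 + e) * c" using e c by simp
    have "(1 + e) * c = 1 - (1 - c) * (2 - c) / 2" by (simp add: e_def field_simps)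
    also have "\<dots> < 1" using c by simp
    finally show "(1 + e) * c < 1" .
  qed
  have "eventually (\<lambda>n. \<forall>I. length I = n \<longrightarrow>
      Opt I \<le> ((1 + e) * c) * (sqrt n / 2) * alg_value A I) sequentially"
    \<comment> \<open>At \<open>n = 0\<close> the quotient is 0 by convention and says nothing about
      \<open>f\<close>.\<close>
    using ev_f ev_h eventually_gt_at_top[of 0]
  proof eventually_elim
    case (elim n)
    then have fn: "f n \<le> c * (sqrt n / 2)" by (simp add: field_simps)
    have "f n + h n \<le> (1 + e) * c * (sqrt n / 2)"
    proof (cases "0 \<le> f n")
      case True
      then have "f n + h n \<le> (1 + e) * f n" using elim(2) by (simp add: algebra_simps)
      also have "\<dots> \<le> (1 + e) * (c * (sqrt n / 2))" using fn e by (intro mult_left_mono) auto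
      finally show ?thesis by (simp add: mult.assoc)
    next
      \<comment> \<open>No sign is imposed on \<open>f\<close>; if \<open>f n\<close> is negative,
        \<open>e < 1\<close> prevents \<open>h n\<close> from making the sum positive.\<close>
      case False
      have "e * norm (f n) \<le> norm (f n)" using e by (intro mult_left_le_one_le) auto
      then have "norm (h n) \<le> norm (f n)" using elim(2) by linarith
      then have "f n + h n \<le> 0" using False by simp
      also have "0 \<le> (1 + e) * c * (sqrt n / 2)" using d by simp
      finally show ?thesis .
    qed
    then show ?case
      using le mult_right_mono[OF _ alg_value_nonneg] order_trans by blast
  qed
  with d show ?thesis using that by blast
qed

theorem theorem1:
  fixes A :: "'a online_alg" and f :: "nat \<Rightarrow> real"
  assumes "infinite (UNIV :: 'a set)"
    and "has_competitive_function A f"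
  shows "\<not> better_than f (\<lambda>n. sqrt (real n) / 2)"
proof
  assume "better_than f (\<lambda>n. sqrt (real n) / 2)"
  moreover have "competitive A f" using assms(2) by (simp add: has_competitive_function_def)
  ultimately obtain d where d: "0 < d" "d < 1" and
    ev: "eventually (\<lambda>n. \<forall>I. length I = n \<longrightarrow> Opt I \<le> d * (sqrt n / 2) * alg_value A I) sequentially"
    using competitive_better_imp_ratio by blast
  then obtain n0 where n0:
    "\<And>I. n0 \<le> length I \<Longrightarrow> Opt I \<le> d * (sqrt (length I) / 2) * alg_value A I"
    unfolding eventually_sequentially by blast
  \<comment> \<open>The two bounds on the input will give
    \<open>(1 - d) * K \<le> 1 + d / 2\<close>, which is below 2, so \<open>(1 - d) * K > 2\<close>
    is contradictory.\<close>
  obtain K0 :: nat where K0: "2 / (1 - d) < K0" using reals_Archimedean2 by blast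
  define K where "K = max K0 (max 2 n0)"
  have K: "2 \<le> K" "n0 \<le> K" "2 / (1 - d) < K" using K0 by (auto simp: K_def)
  obtain I where I: "length I = K ^ 4" "real K ^ 2 - real K \<le> Opt I" "alg_value A I \<le> 2 + 1 / real K"
    using adversarial_input[OF assms(1) K(1)] by blast
  have "K ^ 1 \<le> K ^ 4" using K(1) by (intro power_increasing) auto
  then have "n0 \<le> length I" using K(2) I(1) by simp
  have sqrt: "sqrt (length I) = real K ^ 2"
    by (intro real_sqrt_unique) (simp_all add: I(1))
  have "real K ^ 2 - real K \<le> d * (real K ^ 2 / 2) * alg_value A I"
    using I(2) n0[OF \<open>n0 \<le> length I\<close>] by (simp add: sqrt)
  also have "\<dots> \<le> d * (real K ^ 2 / 2) * (2 + 1 / real K)"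
    using I(3) d by (intro mult_left_mono) auto
  also have "\<dots> = real K * (d * real K + d / 2)"
    using K(1) by (simp add: field_simps power2_eq_square)
  finally have "real K * (real K - 1) \<le> real K * (d * real K + d / 2)"
    by (simp add: algebra_simps power2_eq_square)
  then have "real K - 1 \<le> d * real K + d / 2" using K(1) by simp
  moreover have "2 < (1 - d) * real K" using K(3) d by (simp add: field_simps)
  ultimately show False using d by (simp add: algebra_simps)
qed

end
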